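(* Every finite, simple, undirected, connected chordal graph is distance preserving.
   Context: All graphs are finite, undirected, simple, and connected. A chordal graph is a graph in which any cycle of length four or more has a chord (an edge of the graph joining two vertices of the cycle that are not consecutive on the cycle). The distance $d_G(u,v)$ is the minimal length (number of edges) of a path in $G$ connecting $u$ and $v$. An induced subgraph $H$ of $G$ is called an isometric subgraph of $G$ if $d_H(a,b)=d_G(a,b)$ for every pair of vertices $a,b\in V(H)$ (in particular, since $G$ is connected, an isometric subgraph is connected). A connected graph $G$ is called distance preserving (dp) if and only if it has an isometric subgraph with exactly $i$ vertices for every $1\le i\le |V(G)|$. *)

theory Defs
  imports "Graph_Theory.Graph_Theory" "HOL-Library.Extended_Nat"
begin

text \<open>
  A finite simple undirected graph is an instance of the locale \<^locale>\<open>graph\<close>: a finite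
  symmetric digraph without loops and parallel arcs, so that an undirected edge is a pair of
  opposite arcs.
\<close>

text \<open>
  The value is \<open>\<infinity>\<close> if no path joins \<open>u\<close> to \<open>v\<close>; in particular a disconnected subgraph
  of a connected graph never has the same distances.
\<close>
definition graph_dist :: "('a, 'b) pre_digraph \<Rightarrow> 'a \<Rightarrow> 'a \<Rightarrow> enat" where
  "graph_dist G u v = (INF p \<in> {p. pre_digraph.apath G u p v}. enat (length p))"

text \<open>
  A cycle is a list \<open>p\<close> of arcs, and its \<open>i\<close>-th vertex is \<open>tail G (p ! i)\<close>. The
  two-arc cycles \<open>a, b, a\<close> that \<^const>\<open>pre_digraph.cycle\<close> admits in a symmetric digraph are
  excluded by the bound on the length.
\<close>
definition has_chord :: "('a, 'b) pre_digraph \<Rightarrow> 'b awalk \<Rightarrow> bool" where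
  "has_chord G p \<longleftrightarrow>
     (\<exists>i < length p. \<exists>j < length p.
        i \<noteq> j \<and> j \<noteq> Suc i mod length p \<and> i \<noteq> Suc j mod length p \<and>
        (tail G (p ! i), tail G (p ! j)) \<in> arcs_ends G)"

definition chordal :: "('a, 'b) pre_digraph \<Rightarrow> bool" where
  "chordal G \<longleftrightarrow> (\<forall>p. pre_digraph.cycle G p \<and> 4 \<le> length p \<longrightarrow> has_chord G p)"

definition isometric_subgraph :: "('a, 'b) pre_digraph \<Rightarrow> ('a, 'b) pre_digraph \<Rightarrow> bool" where
  "isometric_subgraph H G \<longleftrightarrow>
     induced_subgraph H G \<and>
     (\<forall>a \<in> verts H. \<forall>b \<in> verts H. graph_dist H a b = graph_dist G a b)"

definition distance_preserving :: "('a, 'b) pre_digraph \<Rightarrow> bool" where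
  "distance_preserving G \<longleftrightarrow>
     (\<forall>i. 1 \<le> i \<and> i \<le> card (verts G) \<longrightarrow>
        (\<exists>H. isometric_subgraph H G \<and> card (verts H) = i))"

end

theory Submission
  imports Defs
begin

text \<open>
  Deleting a simplicial vertex \<open>v\<close> leaves an isometric subgraph, because a walk that passes through
  \<open>v\<close> can be shortened by the edge between the two neighbours of \<open>v\<close> on it. So it suffices to find a
  simplicial vertex in every induced subgraph \<open>W\<close> of a chordal graph. If \<open>W\<close> is not complete, take
  a largest connected \<open>S \<subseteq> W\<close> such that the set \<open>R\<close> of vertices outside \<open>S\<close> without
  neighbours in \<open>S\<close> is nonempty. By maximality every vertex of the boundary \<open>W - S - R\<close> is adjacent
  to all of \<open>R\<close>, and by chordality the boundary is a clique: a shortest path through \<open>S\<close> between two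
  nonadjacent boundary vertices, closed up through a vertex of \<open>R\<close>, would be a chordless cycle. Hence a
  simplicial vertex of \<open>R\<close>, which exists by induction, is simplicial in \<open>W\<close>.
\<close>

section \<open>Simplicial vertices of chordal edge relations\<close>

text \<open>Cycles become injective vertex sequences with indices modulo \<open>n\<close>. On a bare
  relation, passing to an induced subgraph is just intersecting with
  \<open>W \<times> W\<close>.\<close>

definition chordal_rel :: "('a \<times> 'a) set \<Rightarrow> bool" where
  "chordal_rel E \<longleftrightarrow>
     (\<forall>n f. 4 \<le> n \<longrightarrow> inj_on f {..<n} \<longrightarrow> (\<forall>i<n. (f i, f (Suc i mod n)) \<in> E) \<longrightarrow>
        (\<exists>i<n. \<exists>j<n. i \<noteq> j \<and> j \<noteq> Suc i mod n \<and> i \<noteq> Suc j mod n \<and> (f i, f j) \<in> E))"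

definition simplicial_in :: "('a \<times> 'a) set \<Rightarrow> 'a set \<Rightarrow> 'a \<Rightarrow> bool" where
  "simplicial_in E W v \<longleftrightarrow>
     (\<forall>a\<in>W. \<forall>b\<in>W. (v, a) \<in> E \<longrightarrow> (v, b) \<in> E \<longrightarrow> a \<noteq> b \<longrightarrow> (a, b) \<in> E)"

lemma relpow_segment:
  assumes "\<And>k. k < n \<Longrightarrow> (f k, f (Suc k)) \<in> R" and "i \<le> j" "j \<le> n"
  shows "(f i, f j) \<in> R ^^ (j - i)"
  unfolding relpow_fun_conv
  using assms by (intro exI[of _ "\<lambda>k. f (i + k)"]) auto

text \<open>Splicing an \<open>m\<close>-step walk in place of the segment from \<open>f i\<close>
  to \<open>f j\<close> gives a walk of length \<open>i + m + (n - j)\<close>. Later,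
  \<open>m = 0\<close> yields distinct vertices and \<open>m = 1\<close> yields the absence of
  chords.\<close>

lemma shortest_relpow_no_shortcut:
  assumes f: "\<And>k. k < n \<Longrightarrow> (f k, f (Suc k)) \<in> R"
    and least: "\<And>m. (f 0, f n) \<in> R ^^ m \<Longrightarrow> n \<le> m"
    and ij: "i \<le> j" "j \<le> n" and m: "(f i, f j) \<in> R ^^ m"
  shows "j \<le> i + m"
proof -
  have "(f 0, f i) \<in> R ^^ i" "(f j, f n) \<in> R ^^ (n - j)"
    using relpow_segment[of n f R 0 i] relpow_segment[of n f R j n] f ij by auto
  then have "(f 0, f n) \<in> R ^^ (i + m + (n - j))"
    using m unfolding relpow_add by blast
  from least[OF this] ij show ?thesis by linarith
qed

text \<open>This makes the boundary of a connected set \<open>S\<close> a clique: \<open>x\<close>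
  and \<open>y\<close> are boundary vertices, and \<open>r\<close> is a common neighbour on the far
  side.\<close>

lemma chordal_rel_boundary_adjacent:
  assumes E: "chordal_rel E" "sym E" "irrefl E"
    and S: "\<And>a b. a \<in> S \<Longrightarrow> b \<in> S \<Longrightarrow> (a, b) \<in> (E \<inter> S \<times> S)\<^sup>*"
    and x: "s \<in> S" "(x, s) \<in> E" and y: "t \<in> S" "(y, t) \<in> E"
    and r: "r \<notin> S" "\<And>s. s \<in> S \<Longrightarrow> (s, r) \<notin> E" "(x, r) \<in> E" "(y, r) \<in> E"
    and "x \<noteq> y"
  shows "(x, y) \<in> E"
proof (rule ccontr)
  assume nadj: "(x, y) \<notin> E"
  \<comment> \<open>Within \<open>T\<close>, the interior of a shortest path from \<open>x\<close>
    to \<open>y\<close> is forced into \<open>S\<close>.\<close>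
  define T where "T = insert x (insert y S)"
  define R where "R = E \<inter> T \<times> T"
  have symD: "(b, a) \<in> E" if "(a, b) \<in> E" for a b using E(2) that by (auto dest: symD)
  have irr: "(a, a) \<notin> E" for a using E(3) by (auto simp: irrefl_def)
  have "(s, t) \<in> R\<^sup>*"
    using S[OF x(1) y(1)] by (rule rtrancl_mono[THEN subsetD, rotated]) (auto simp: R_def T_def)
  moreover have "(x, s) \<in> R" "(t, y) \<in> R" using x y symD by (auto simp: R_def T_def)
  ultimately have "(x, y) \<in> R\<^sup>*" by (meson converse_rtrancl_into_rtrancl rtrancl.rtrancl_into_rtrancl)
  then have ex: "\<exists>n. (x, y) \<in> R ^^ n" by (rule rtrancl_imp_relpow)
  define n where "n = (LEAST n. (x, y) \<in> R ^^ n)"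
  have "(x, y) \<in> R ^^ n" unfolding n_def using ex by (rule LeastI_ex)
  then obtain f where f0: "f 0 = x" and fn: "f n = y"
    and f: "\<And>k. k < n \<Longrightarrow> (f k, f (Suc k)) \<in> R"
    unfolding relpow_fun_conv by blast
  have least: "n \<le> m" if "(f 0, f n) \<in> R ^^ m" for m
    using that unfolding f0 fn unfolding n_def by (rule Least_le)
  have short: "j \<le> i + m" if "i \<le> j" "j \<le> n" "(f i, f j) \<in> R ^^ m" for i j m
    by (rule shortest_relpow_no_shortcut[OF f least that])
  have n: "2 \<le> n"
  proof (rule ccontr)
    assume "\<not> 2 \<le> n"
    then have "n = 0 \<or> n = 1" by linarith
    then show False using f0 fn f[of 0] \<open>x \<noteq> y\<close> nadj by (auto simp: R_def)
  qed
  have fT: "f i \<in> T" if "i \<le> n" for i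
    using that f[of i] fn by (cases "i = n") (auto simp: R_def T_def)
  have neq: "f i \<noteq> f j" if "i < j" "j \<le> n" for i j
    using short[of i j 0] that by auto
  have rT: "r \<notin> T" using r irr by (auto simp: T_def)
  \<comment> \<open>Interior vertices differ from both ends \<open>x\<close> and \<open>y\<close>,
    so they lie in \<open>S\<close>, which has no edge to \<open>r\<close>.\<close>
  have mid: "(f i, r) \<notin> E" if "0 < i" "i < n" for i
    using fT[of i] neq[of 0 i] neq[of i n] that r(2) by (auto simp: T_def f0 fn)
  have adj: "j = Suc i" if "i < j" "j \<le> n" "(f i, f j) \<in> E" for i j
    using short[of i j 1] that fT[of i] fT[of j] by (auto simp: R_def)
  \<comment> \<open>The path has \<open>n + 1\<close> vertices; \<open>r\<close> at index
    \<open>n + 1\<close> closes it to a cycle of length \<open>n + 2\<close>, which is at least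
    4.\<close>
  define g where "g i = (if i \<le> n then f i else r)" for i
  define N where "N = Suc (Suc n)"
  have "4 \<le> N" using n by (simp add: N_def)
  moreover have "inj_on g {..<N}"
  proof (rule linorder_inj_onI)
    fix i j assume "i < j" "i \<in> {..<N}" "j \<in> {..<N}"
    then show "g i \<noteq> g j"
      using neq[of i j] fT[of i] rT by (auto simp: g_def N_def)
  qed auto
  moreover have "(g i, g (Suc i mod N)) \<in> E" if iN: "i < N" for i
  proof -
    consider "i < n" | "i = n" | "i = Suc n" using iN unfolding N_def by linarith
    then show ?thesis
      by cases (use f[of i] r f0 fn symD in \<open>auto simp: g_def N_def R_def\<close>)
  qed
  ultimately obtain i j where ij: "i < N" "j < N" "i \<noteq> j" "j \<noteq> Suc i mod N" "i \<noteq> Suc j mod N"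
    "(g i, g j) \<in> E"
    using E(1) unfolding chordal_rel_def by blast
  \<comment> \<open>A chord at \<open>r\<close> is excluded by \<open>mid\<close>, as the ends of
    the path are cyclic neighbours of \<open>r\<close>; a chord within the path is excluded by
    \<open>adj\<close>.\<close>
  have no_chord: False if "i < j" "j < N" "j \<noteq> Suc i mod N" "i \<noteq> Suc j mod N" "(g i, g j) \<in> E" for i j
  proof (cases "j = Suc n")
    case True
    then show False using that mid[of i] by (cases "i = 0"; cases "i = n") (auto simp: g_def N_def)
  next
    case False
    then show False using that adj[of i j] by (auto simp: g_def N_def)
  qed
  from ij show False
    using no_chord[of i j] no_chord[of j i] symD by (cases "i < j") auto
qed

text \<open>Induction on \<open>W\<close> with \<open>E\<close> fixed. A vertex of
  \<open>far S\<close> has all its neighbours in \<open>W\<close> outside \<open>S\<close>, so they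
  lie in \<open>far S\<close> or in the boundary, and three kinds of pairs have to be
  checked.\<close>

lemma chordal_rel_simplicial_vertex:
  assumes E: "chordal_rel E" "sym E" "irrefl E" and "finite W" "W \<noteq> {}"
  shows "\<exists>v\<in>W. simplicial_in E W v"
  using assms(4,5)
proof (induction W rule: finite_psubset_induct)
  case (psubset W)
  have symD: "(b, a) \<in> E" if "(a, b) \<in> E" for a b using E(2) that by (auto dest: symD)
  show ?case
  proof (cases "\<forall>a\<in>W. \<forall>b\<in>W. a \<noteq> b \<longrightarrow> (a, b) \<in> E")
    case True
    with psubset.prems show ?thesis by (auto simp: simplicial_in_def)
  next
    case False
    then obtain a b where ab: "a \<in> W" "b \<in> W" "a \<noteq> b" "(a, b) \<notin> E" by blast
    define far where "far S = {r \<in> W - S. \<forall>s\<in>S. (s, r) \<notin> E}" for S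
    define P where "P S \<longleftrightarrow> S \<subseteq> W \<and> S \<noteq> {} \<and> far S \<noteq> {} \<and>
      (\<forall>a\<in>S. \<forall>b\<in>S. (a, b) \<in> (E \<inter> S \<times> S)\<^sup>*)" for S
    \<comment> \<open>The nonadjacent vertex \<open>b\<close> witnesses that \<open>far {a}\<close>
      is nonempty.\<close>
    have "P {a}" using ab by (auto simp: P_def far_def)
    moreover have bound: "\<forall>S. P S \<longrightarrow> card S < Suc (card W)"
      using psubset.hyps by (auto simp: P_def less_Suc_eq_le intro: card_mono)
    ultimately obtain S where S: "P S" and max: "\<And>S'. P S' \<Longrightarrow> card S' \<le> card S"
      using ex_has_greatest_nat[of P "{a}" card "Suc (card W)"] by auto
    have SW: "S \<subseteq> W" and conn: "\<And>a b. a \<in> S \<Longrightarrow> b \<in> S \<Longrightarrow> (a, b) \<in> (E \<inter> S \<times> S)\<^sup>*"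
      using S by (auto simp: P_def)
    have "finite S" using SW psubset.hyps finite_subset by blast
    have "far S \<subset> W" using S by (auto simp: P_def far_def)
    then obtain v where v: "v \<in> far S" "simplicial_in E (far S) v"
      using psubset.IH[of "far S"] S by (auto simp: P_def)
    \<comment> \<open>Otherwise \<open>x\<close>, which has a neighbour in \<open>S\<close>, could
      be added to \<open>S\<close> while \<open>r\<close> stays far, against maximality.\<close>
    have boundary: "(x, r) \<in> E" if x: "x \<in> W" "x \<notin> S" "x \<notin> far S" and r: "r \<in> far S" for x r
    proof (rule ccontr)
      assume "(x, r) \<notin> E"
      with x r have "far (insert x S) \<noteq> {}" by (auto simp: far_def)
      moreover have "(a, b) \<in> (E \<inter> insert x S \<times> insert x S)\<^sup>*"
        if "a \<in> insert x S" "b \<in> insert x S" for a b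
      proof -
        let ?R = "E \<inter> insert x S \<times> insert x S"
        obtain s where s: "s \<in> S" "(s, x) \<in> E" using x by (auto simp: far_def)
        have old: "(c, d) \<in> ?R\<^sup>*" if "c \<in> S" "d \<in> S" for c d
          using conn[OF that] by (rule rtrancl_mono[THEN subsetD, rotated]) auto
        have sx: "(s, x) \<in> ?R" "(x, s) \<in> ?R" using s symD by auto
        have "(a, s) \<in> ?R\<^sup>*" "(s, b) \<in> ?R\<^sup>*"
          using that old s(1) sx by (auto intro: r_into_rtrancl)
        then show ?thesis by (rule rtrancl_trans)
      qed
      ultimately have "P (insert x S)" using SW x(1) by (auto simp: P_def)
      from max[OF this] show False using x(2) \<open>finite S\<close> by simp
    qed
    have "(c, d) \<in> E" if cd: "c \<in> W" "d \<in> W" "(v, c) \<in> E" "(v, d) \<in> E" "c \<noteq> d" for c d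
    proof -
      have nS: "c \<notin> S" "d \<notin> S" using cd v(1) symD by (auto simp: far_def)
      show ?thesis
      proof (cases "c \<in> far S"; cases "d \<in> far S")
        assume "c \<in> far S" "d \<in> far S"
        then show ?thesis using v(2) cd by (auto simp: simplicial_in_def)
      next
        assume "c \<in> far S" "d \<notin> far S"
        then show ?thesis using boundary[of d c] cd nS symD by auto
      next
        assume "c \<notin> far S" "d \<in> far S"
        then show ?thesis using boundary[of c d] cd nS by auto
      next
        assume nf: "c \<notin> far S" "d \<notin> far S"
        then obtain s t where "s \<in> S" "(c, s) \<in> E" "t \<in> S" "(d, t) \<in> E"
          using cd nS symD by (fastforce simp: far_def)
        then show ?thesis
          using chordal_rel_boundary_adjacent[OF E conn, of s c t d v] v(1) cd symD
          by (auto simp: far_def)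
      qed
    qed
    then have "simplicial_in E W v" by (auto simp: simplicial_in_def)
    with v(1) show ?thesis by (auto simp: far_def)
  qed
qed

section \<open>Deleting simplicial vertices one by one\<close>

text \<open>A visit to \<open>v\<close> between neighbours \<open>a\<close> and \<open>d\<close> is
  replaced by the edge from \<open>a\<close> to \<open>d\<close>, or dropped if
  \<open>a = d\<close>. Such a bypass consumes two steps, hence the strong induction.\<close>

lemma relpow_avoid_simplicial:
  assumes "simplicial_in E W v" "sym E" "irrefl E"
    and "(a, b) \<in> (E \<inter> W \<times> W) ^^ n" "a \<noteq> v" "b \<noteq> v"
  shows "\<exists>m\<le>n. (a, b) \<in> (E \<inter> (W - {v}) \<times> (W - {v})) ^^ m"
  using assms(4,5)
proof (induction n arbitrary: a rule: less_induct)
  case (less n)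
  let ?R = "E \<inter> W \<times> W" and ?Q = "E \<inter> (W - {v}) \<times> (W - {v})"
  show ?case
  proof (cases n)
    case 0
    with less.prems show ?thesis by auto
  next
    case (Suc k)
    then obtain c where c: "(a, c) \<in> ?R" "(c, b) \<in> ?R ^^ k"
      using less.prems(1) by (meson relpow_Suc_D2)
    show ?thesis
    proof (cases "c = v")
      case False
      then obtain m where "m \<le> k" "(c, b) \<in> ?Q ^^ m"
        using less.IH[of k c] c(2) Suc by auto
      moreover have "(a, c) \<in> ?Q" using c(1) False less.prems(2) by auto
      ultimately show ?thesis using Suc by (meson Suc_le_mono relpow_Suc_I2)
    next
      case True
      \<comment> \<open>The walk cannot stop at \<open>v\<close>, since its end \<open>b\<close>
        differs from \<open>v\<close>.\<close>
      then obtain l where l: "k = Suc l" using c(2) assms(6) by (cases k) auto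
      then obtain d where d: "(v, d) \<in> ?R" "(d, b) \<in> ?R ^^ l"
        using c(2) True by (meson relpow_Suc_D2)
      have "d \<noteq> v" using d(1) assms(3) by (auto simp: irrefl_def)
      then obtain m where m: "m \<le> l" "(d, b) \<in> ?Q ^^ m"
        using less.IH[of l d] d(2) Suc l by auto
      show ?thesis
      proof (cases "a = d")
        case True
        with m Suc l show ?thesis by (intro exI[of _ m]) auto
      next
        case False
        have "(v, a) \<in> E" using c(1) True assms(2) by (auto dest: symD)
        then have "(a, d) \<in> E"
          using assms(1) c(1) d(1) False by (auto simp: simplicial_in_def)
        then have "(a, d) \<in> ?Q" using c(1) d(1) less.prems(2) \<open>d \<noteq> v\<close> by auto
        with m(2) have "(a, b) \<in> ?Q ^^ Suc m" by (meson relpow_Suc_I2)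
        with m(1) Suc l show ?thesis by (intro exI[of _ "Suc m"]) auto
      qed
    qed
  qed
qed

text \<open>Isometry is phrased as the existence of walks that are no longer, a condition that
  composes along successive deletions.\<close>

lemma chordal_rel_isometric_subset:
  assumes E: "chordal_rel E" "sym E" "irrefl E" and W: "finite W" "i \<le> card W"
  shows "\<exists>U\<subseteq>W. card U = i \<and> (\<forall>a\<in>U. \<forall>b\<in>U. \<forall>n. (a, b) \<in> (E \<inter> W \<times> W) ^^ n \<longrightarrow>
    (\<exists>m\<le>n. (a, b) \<in> (E \<inter> U \<times> U) ^^ m))"
  using W
proof (induction W rule: finite_psubset_induct)
  case (psubset W)
  show ?case
  proof (cases "i = card W")
    case True
    then show ?thesis by (intro exI[of _ W]) auto
  next
    case False
    then have "W \<noteq> {}" "i \<le> card W - 1" using psubset.prems by auto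
    then obtain v where v: "v \<in> W" "simplicial_in E W v"
      using chordal_rel_simplicial_vertex[OF E psubset.hyps] by blast
    let ?W = "W - {v}"
    have "i \<le> card ?W" using v(1) \<open>i \<le> card W - 1\<close> psubset.hyps by simp
    then obtain U where U: "U \<subseteq> ?W" "card U = i"
      and iso: "\<And>a b n. a \<in> U \<Longrightarrow> b \<in> U \<Longrightarrow> (a, b) \<in> (E \<inter> ?W \<times> ?W) ^^ n \<Longrightarrow>
        \<exists>m\<le>n. (a, b) \<in> (E \<inter> U \<times> U) ^^ m"
      using psubset.IH[of ?W] v(1) by blast
    have "\<exists>m\<le>n. (a, b) \<in> (E \<inter> U \<times> U) ^^ m"
      if ab: "a \<in> U" "b \<in> U" "(a, b) \<in> (E \<inter> W \<times> W) ^^ n" for a b n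
    proof -
      obtain k where "k \<le> n" "(a, b) \<in> (E \<inter> ?W \<times> ?W) ^^ k"
        using relpow_avoid_simplicial[OF v(2) E(2,3) ab(3)] U(1) ab by blast
      then show ?thesis using iso[OF ab(1,2)] by (meson order_trans)
    qed
    then show ?thesis using U by (intro exI[of _ U]) auto
  qed
qed

section \<open>Translation between relation powers and walks, distances and cycles\<close>

context wf_digraph
begin

lemma awalk_imp_relpow: "awalk u p v \<Longrightarrow> (u, v) \<in> arcs_ends G ^^ length p"
  by (induction p arbitrary: u)
    (auto simp: awalk_simps intro: relpow_Suc_I2 in_arcs_imp_in_arcs_ends simp del: relpow.simps(2))

lemma relpow_imp_awalk:
  "(u, v) \<in> arcs_ends G ^^ n \<Longrightarrow> u \<in> verts G \<Longrightarrow> \<exists>p. awalk u p v \<and> length p = n"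
proof (induction n arbitrary: u)
  case 0
  then show ?case by (auto simp: awalk_Nil_iff)
next
  case (Suc n)
  from Suc.prems(1) obtain w where w: "(u, w) \<in> arcs_ends G" "(w, v) \<in> arcs_ends G ^^ n"
    by (meson relpow_Suc_D2)
  then obtain e where e: "e \<in> arcs G" "tail G e = u" "head G e = w" by (auto elim: reachableE)
  with Suc.IH[OF w(2)] obtain p where "awalk w p v" "length p = n" by auto
  with e show ?case by (intro exI[of _ "e # p"]) (auto simp: awalk_Cons_iff)
qed

text \<open>Cutting out closed subwalks turns a walk into a path that is no longer.\<close>

lemma graph_dist_le_awalk:
  assumes "awalk u p v"
  shows "graph_dist G u v \<le> enat (length p)"
proof -
  have "\<exists>q. apath u q v \<and> length q \<le> length p"
    using assms
  proof (induction rule: awalk_to_apath_induct)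
    case (path p)
    then show ?case by (auto simp: apath_def)
  next
    case (decomp p q r s)
    then have "p = q @ r @ s" using awalk_cyc_decomp_has_prop[of u p v] by auto
    with decomp show ?case by auto
  qed
  then obtain q where q: "apath u q v" "length q \<le> length p" by blast
  then have "graph_dist G u v \<le> enat (length q)"
    unfolding graph_dist_def by (intro INF_lower) simp
  with q(2) show ?thesis by (meson enat_ord_simps(1) order_trans)
qed

text \<open>One inequality is \<open>iso\<close> read through walks; the other holds because walks
  of the induced subgraph are walks of \<open>G\<close>.\<close>

lemma graph_dist_induce_subgraph:
  assumes U: "U \<subseteq> verts G" "a \<in> U" "b \<in> U"
    and iso: "\<And>n. (a, b) \<in> arcs_ends G ^^ n \<Longrightarrow> \<exists>m\<le>n. (a, b) \<in> (arcs_ends G \<inter> U \<times> U) ^^ m"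
  shows "graph_dist (G \<restriction> U) a b = graph_dist G a b"
proof (rule antisym)
  interpret H: wf_digraph "G \<restriction> U" by (rule wellformed_induce_subgraph)
  have ends: "arcs_ends (G \<restriction> U) = arcs_ends G \<inter> U \<times> U"
    by (auto simp: arcs_ends_conv)
  show "graph_dist (G \<restriction> U) a b \<le> graph_dist G a b"
    unfolding graph_dist_def[of G]
  proof (rule INF_greatest)
    fix p assume "p \<in> {p. apath a p b}"
    then obtain m where m: "m \<le> length p" "(a, b) \<in> arcs_ends (G \<restriction> U) ^^ m"
      using iso[of "length p"] by (auto simp: ends dest: awalkI_apath awalk_imp_relpow)
    then obtain q where "H.awalk a q b" "length q = m"
      using H.relpow_imp_awalk U by fastforce
    with m(1) show "graph_dist (G \<restriction> U) a b \<le> enat (length p)"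
      using H.graph_dist_le_awalk by (meson enat_ord_simps(1) order_trans)
  qed
  show "graph_dist G a b \<le> graph_dist (G \<restriction> U) a b"
    unfolding graph_dist_def[of "G \<restriction> U"]
  proof (rule INF_greatest)
    fix p assume "p \<in> {p. H.apath a p b}"
    then have "H.awalk a p b" by (auto simp: H.awalkI_apath)
    then have "(a, b) \<in> (arcs_ends G \<inter> U \<times> U) ^^ length p"
      using H.awalk_imp_relpow ends by metis
    then have "(a, b) \<in> arcs_ends G ^^ length p"
      unfolding relpow_fun_conv by blast
    then obtain q where "awalk a q b" "length q = length p"
      using relpow_imp_awalk U by blast
    then show "graph_dist G a b \<le> enat (length p)" using graph_dist_le_awalk by metis
  qed
qed

lemma cas_map_upt:
  assumes "\<And>i. i < n \<Longrightarrow> tail G (e i) = f i" "\<And>i. i < n \<Longrightarrow> head G (e i) = f (Suc i)" "m \<le> n"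
  shows "cas (f m) (map e [m..<n]) (f n)"
  using assms(3)
proof (induction m rule: inc_induct)
  case base
  then show ?case by simp
next
  case (step m)
  then show ?case using assms(1,2)[of m] by (simp add: upt_conv_Cons)
qed

text \<open>Choosing an arc for each cyclically consecutive pair gives a cycle whose
  \<open>i\<close>-th tail is \<open>f i\<close>, so chord indices carry over unchanged.\<close>

lemma chordal_imp_chordal_rel:
  assumes "chordal G"
  shows "chordal_rel (arcs_ends G)"
  unfolding chordal_rel_def
proof (intro allI impI)
  fix n and f :: "nat \<Rightarrow> 'a"
  assume n: "4 \<le> n" and inj: "inj_on f {..<n}"
    and f: "\<forall>i<n. (f i, f (Suc i mod n)) \<in> arcs_ends G"
  then have "\<forall>i. \<exists>e. i < n \<longrightarrow> e \<in> arcs G \<and> tail G e = f i \<and> head G e = f (Suc i mod n)"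
    by (metis reachableE)
  then obtain e where e: "\<And>i. i < n \<Longrightarrow> e i \<in> arcs G" "\<And>i. i < n \<Longrightarrow> tail G (e i) = f i"
    "\<And>i. i < n \<Longrightarrow> head G (e i) = f (Suc i mod n)"
    by metis
  define p where "p = map e [0..<n]"
  have len: "length p = n" and nth: "\<And>i. i < n \<Longrightarrow> tail G (p ! i) = f i"
    using e by (auto simp: p_def)
  \<comment> \<open>The vertex sequence used here is \<open>f (i mod n)\<close>, whose value at
    \<open>n\<close> returns to \<open>f 0\<close>.\<close>
  have "cas (f (0 mod n)) p (f (n mod n))"
    unfolding p_def by (rule cas_map_upt) (use e in auto)
  then have cas: "cas (f 0) p (f 0)" by simp
  have "f 0 \<in> verts G" using e(1,2)[of 0] tail_in_verts[of "e 0"] n by simp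
  then have "awalk (f 0) p (f 0)" using cas e(1) by (auto simp: awalk_def p_def)
  moreover have "distinct (tl (awalk_verts (f 0) p))"
  proof -
    have "tl (awalk_verts (f 0) p) = map (head G) p"
      by (simp add: awalk_verts_conv'[OF cas])
    also have "\<dots> = map (\<lambda>i. f (Suc i mod n)) [0..<n]"
      using e(3) by (simp add: p_def)
    finally have "tl (awalk_verts (f 0) p) = map (\<lambda>i. f (Suc i mod n)) [0..<n]" .
    \<comment> \<open>The heads run through \<open>f\<close> shifted cyclically by one, so each
      vertex occurs once.\<close>
    moreover have "inj_on (\<lambda>i. f (Suc i mod n)) {0..<n}"
    proof (rule inj_onI)
      fix i j assume ij: "i \<in> {0..<n}" "j \<in> {0..<n}" "f (Suc i mod n) = f (Suc j mod n)"
      then have "Suc i mod n = Suc j mod n" using inj n by (auto dest!: inj_onD)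
      then show "i = j" using ij by (auto simp: mod_Suc split: if_splits)
    qed
    ultimately show ?thesis by (simp add: distinct_map)
  qed
  moreover have "p \<noteq> []" using len n by auto
  ultimately have "cycle p" by (auto simp: cycle_def)
  then have "has_chord G p" using assms n len by (auto simp: chordal_def)
  then show "\<exists>i<n. \<exists>j<n. i \<noteq> j \<and> j \<noteq> Suc i mod n \<and> i \<noteq> Suc j mod n \<and> (f i, f j) \<in> arcs_ends G"
    unfolding has_chord_def len using nth by metis
qed

end

theorem corollary3p2:
  fixes G :: "('a, 'b) pre_digraph"
  assumes "graph G"
    and "connected G"
    and "chordal G"
  shows "distance_preserving G"
proof -
  interpret graph G by fact
  let ?E = "arcs_ends G"
  have "chordal_rel ?E" using assms(3) by (rule chordal_imp_chordal_rel)
  moreover have "sym ?E" using sym_arcs by (simp add: symmetric_def)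
  moreover have "irrefl ?E" using adj_not_same by (auto simp: irrefl_def)
  \<comment> \<open>For the full vertex set the restriction disappears, leaving walks of
    \<open>G\<close> itself.\<close>
  moreover have "?E \<inter> verts G \<times> verts G = ?E" by (auto simp: arcs_ends_conv)
  ultimately have "\<exists>U\<subseteq>verts G. card U = i \<and> (\<forall>a\<in>U. \<forall>b\<in>U. \<forall>n. (a, b) \<in> ?E ^^ n \<longrightarrow>
      (\<exists>m\<le>n. (a, b) \<in> (?E \<inter> U \<times> U) ^^ m))" if "i \<le> card (verts G)" for i
    using chordal_rel_isometric_subset[of ?E "verts G" i] that by simp
  then show ?thesis
    unfolding distance_preserving_def isometric_subgraph_def
    by (metis graph_dist_induce_subgraph induce_subgraph_verts induced_induce)
qed

end
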